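(* For a $T_0$ space $X$, the following conditions are equivalent: (1) $X$ is sober. (2) $X$ is a $\mathsf{DC}$ space and a $d$-space. (3) $X$ is well-filtered and a $\mathsf{DC}$ space. (4) $X$ is well-filtered and a Rudin space. (5) $X$ is well-filtered and a $\mathsf{WD}$ space.
   Context: For a $T_0$ space $X$, the specialization order is $x\le y$ iff $x\in\overline{\{y\}}$; order notions refer to it. A nonempty subset $A$ is irreducible if whenever $A\subseteq F_1\cup F_2$ with $F_1,F_2$ closed, then $A\subseteq F_1$ or $A\subseteq F_2$. $X$ is sober if every irreducible closed set is $\overline{\{a\}}$ for a unique $a\in X$. $X$ is a $d$-space if $X$ with the specialization order is a dcpo (every directed subset has a supremum) and every open set of $X$ is Scott open for this order. $\mathsf{K}(X)$ is the set of nonempty compact saturated subsets (saturated = upper set in the specialization order). A family $\mathcal K\subseteq \mathsf K(X)$ is filtered if it is nonempty and for all $K_1,K_2\in\mathcal K$ there is $K_3\in\mathcal K$ with $K_3\subseteq K_1\cap K_2$. A space $Y$ is well-filtered if it is $T_0$ and for every open $U\subseteq Y$ and every filtered family $\mathcal K\subseteq\mathsf K(Y)$, $\bigcap\mathcal K\subseteq U$ implies $K\subseteq U$ for some $K\in\mathcal K$. $X$ is a $\mathsf{DC}$ space (directed closure space) if every irreducible closed subset of $X$ is the closure of a directed subset of $X$. A Rudin set is a nonempty closed subset $A$ of $X$ for which there is a filtered family $\mathcal K\subseteq\mathsf K(X)$ such that $A$ is minimal (under inclusion) among the closed subsets of $X$ that meet every member of $\mathcal K$; $X$ is a Rudin space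 if every irreducible closed subset of $X$ is a Rudin set. A subset $A\subseteq X$ is well-filtered determined if for every continuous map $f:X\to Y$ to a well-filtered space $Y$ there is a unique $y_A\in Y$ with $\overline{f(A)}=\overline{\{y_A\}}$; $X$ is a well-filtered determined space ($\mathsf{WD}$ space) if every irreducible closed subset of $X$ is well-filtered determined. *)

theory Defs
  imports "HOL-Analysis.Analysis"
begin

text \<open>Spaces are abstract topologies with an explicit carrier \<^const>\<open>topspace\<close>. All order
  notions refer to the specialization order on that carrier.\<close>

definition specialization_le :: "'a topology \<Rightarrow> 'a \<Rightarrow> 'a \<Rightarrow> bool" where
  "specialization_le X x y \<longleftrightarrow>
     x \<in> topspace X \<and> y \<in> topspace X \<and> x \<in> X closure_of {y}"

definition upper_in :: "'a topology \<Rightarrow> 'a set \<Rightarrow> bool" where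
  "upper_in X A \<longleftrightarrow>
     A \<subseteq> topspace X \<and> (\<forall>x y. x \<in> A \<longrightarrow> specialization_le X x y \<longrightarrow> y \<in> A)"

definition directed_in :: "'a topology \<Rightarrow> 'a set \<Rightarrow> bool" where
  "directed_in X D \<longleftrightarrow>
     D \<noteq> {} \<and> D \<subseteq> topspace X \<and>
     (\<forall>x\<in>D. \<forall>y\<in>D. \<exists>z\<in>D. specialization_le X x z \<and> specialization_le X y z)"

definition is_sup_in :: "'a topology \<Rightarrow> 'a set \<Rightarrow> 'a \<Rightarrow> bool" where
  "is_sup_in X D s \<longleftrightarrow>
     s \<in> topspace X \<and> (\<forall>x\<in>D. specialization_le X x s) \<and>
     (\<forall>u\<in>topspace X. (\<forall>x\<in>D. specialization_le X x u) \<longrightarrow> specialization_le X s u)"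

definition specialization_dcpo :: "'a topology \<Rightarrow> bool" where
  "specialization_dcpo X \<longleftrightarrow> (\<forall>D. directed_in X D \<longrightarrow> (\<exists>s. is_sup_in X D s))"

definition scott_open :: "'a topology \<Rightarrow> 'a set \<Rightarrow> bool" where
  "scott_open X U \<longleftrightarrow>
     upper_in X U \<and>
     (\<forall>D s. directed_in X D \<longrightarrow> is_sup_in X D s \<longrightarrow> s \<in> U \<longrightarrow> D \<inter> U \<noteq> {})"

definition d_space :: "'a topology \<Rightarrow> bool" where
  "d_space X \<longleftrightarrow>
     t0_space X \<and> specialization_dcpo X \<and> (\<forall>U. openin X U \<longrightarrow> scott_open X U)"

definition irreducible_in :: "'a topology \<Rightarrow> 'a set \<Rightarrow> bool" where
  "irreducible_in X A \<longleftrightarrow>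
     A \<noteq> {} \<and> A \<subseteq> topspace X \<and>
     (\<forall>F1 F2. closedin X F1 \<longrightarrow> closedin X F2 \<longrightarrow> A \<subseteq> F1 \<union> F2 \<longrightarrow> A \<subseteq> F1 \<or> A \<subseteq> F2)"

definition sober_space :: "'a topology \<Rightarrow> bool" where
  "sober_space X \<longleftrightarrow>
     t0_space X \<and>
     (\<forall>A. closedin X A \<longrightarrow> irreducible_in X A \<longrightarrow>
        (\<exists>!a. a \<in> topspace X \<and> A = X closure_of {a}))"

definition DC_space :: "'a topology \<Rightarrow> bool" where
  "DC_space X \<longleftrightarrow>
     t0_space X \<and>
     (\<forall>A. closedin X A \<longrightarrow> irreducible_in X A \<longrightarrow>
        (\<exists>D. directed_in X D \<and> A = X closure_of D))"

definition compact_saturated :: "'a topology \<Rightarrow> 'a set set" where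
  "compact_saturated X = {K. K \<noteq> {} \<and> compactin X K \<and> upper_in X K}"

definition filtered_family :: "'a topology \<Rightarrow> 'a set set \<Rightarrow> bool" where
  "filtered_family X \<K> \<longleftrightarrow>
     \<K> \<noteq> {} \<and> \<K> \<subseteq> compact_saturated X \<and>
     (\<forall>K1\<in>\<K>. \<forall>K2\<in>\<K>. \<exists>K3\<in>\<K>. K3 \<subseteq> K1 \<inter> K2)"

definition well_filtered_space :: "'a topology \<Rightarrow> bool" where
  "well_filtered_space X \<longleftrightarrow>
     t0_space X \<and>
     (\<forall>U \<K>. openin X U \<longrightarrow> filtered_family X \<K> \<longrightarrow> \<Inter>\<K> \<subseteq> U \<longrightarrow> (\<exists>K\<in>\<K>. K \<subseteq> U))"

definition meets_all :: "'a set \<Rightarrow> 'a set set \<Rightarrow> bool" where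
  "meets_all A \<K> \<longleftrightarrow> (\<forall>K\<in>\<K>. A \<inter> K \<noteq> {})"

definition rudin_set :: "'a topology \<Rightarrow> 'a set \<Rightarrow> bool" where
  "rudin_set X A \<longleftrightarrow>
     A \<noteq> {} \<and> closedin X A \<and>
     (\<exists>\<K>. filtered_family X \<K> \<and> meets_all A \<K> \<and>
        (\<forall>B. closedin X B \<longrightarrow> meets_all B \<K> \<longrightarrow> B \<subseteq> A \<longrightarrow> B = A))"

definition rudin_space :: "'a topology \<Rightarrow> bool" where
  "rudin_space X \<longleftrightarrow>
     t0_space X \<and> (\<forall>A. closedin X A \<longrightarrow> irreducible_in X A \<longrightarrow> rudin_set X A)"

text \<open>The definition of a well-filtered determined set quantifies over all well-filtered
  spaces. A HOL formula cannot quantify over types, so the type from which the target spaces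
  take their points is a parameter \<open>'u\<close>. A target space is an arbitrary topology on
  an arbitrary subset of that type.

  At the type \<open>'a + 'b\<close>, with \<open>'a\<close> the point type of \<open>X\<close> and \<open>'b\<close> a free type variable,
  the target spaces include, up to homeomorphism, every well-filtered space with points in
  \<open>'b\<close>. They also include a copy of \<open>X\<close> itself if \<open>X\<close> is well-filtered. Since \<open>'b\<close> is
  arbitrary, this covers all well-filtered target spaces.\<close>

definition WD_set :: "'u itself \<Rightarrow> 'a topology \<Rightarrow> 'a set \<Rightarrow> bool" where
  "WD_set u X A \<longleftrightarrow>
     A \<subseteq> topspace X \<and>
     (\<forall>(Y :: 'u topology) f. well_filtered_space Y \<longrightarrow> continuous_map X Y f \<longrightarrow>
        (\<exists>!y. y \<in> topspace Y \<and> Y closure_of (f ` A) = Y closure_of {y}))"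

definition WD_space :: "'u itself \<Rightarrow> 'a topology \<Rightarrow> bool" where
  "WD_space u X \<longleftrightarrow>
     t0_space X \<and> (\<forall>A. closedin X A \<longrightarrow> irreducible_in X A \<longrightarrow> WD_set u X A)"

end

theory Submission
  imports Defs
begin

text \<open>Sobriety yields each of the other conditions by taking the generic point \<open>a\<close> of an
  irreducible closed set: \<open>{a}\<close> is directed, and the principal filter of \<open>a\<close> is a one-element
  filtered family witnessing the Rudin property. For well-filteredness, suppose an open set
  contains no member of a filtered family \<open>\<K>\<close>. By Zorn's lemma and compactness it extends to a
  maximal such open set; filteredness makes its complement irreducible, and the generic point of
  the complement lies in \<open>\<Inter>\<K>\<close>.

  Conversely, in a DC space that is a d-space, the supremum of a directed set generates its
  closure. A DC space is always Rudin, with \<open>\<K>\<close> the principal filters of the elements of the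
  directed set. In a well-filtered space a Rudin set \<open>A\<close> meets \<open>\<Inter>\<K>\<close>, and minimality
  makes \<open>A\<close> the closure of any point of \<open>A \<inter> \<Inter>\<K>\<close>. Finally, a well-filtered WD space is
  sober, as one sees by testing the WD property on a homeomorphism from the space onto a copy
  of it in the target type.\<close>

section \<open>The specialization order\<close>

lemma specialization_le_refl: "x \<in> topspace X \<Longrightarrow> specialization_le X x x"
  using closure_of_subset[of "{x}" X] by (auto simp: specialization_le_def)

lemma specialization_le_trans:
  assumes "specialization_le X x y" "specialization_le X y z"
  shows "specialization_le X x z"
  using assms closure_of_minimal[of "{y}" "X closure_of {z}" X]
  by (auto simp: specialization_le_def)

lemma specialization_le_closedin:
  "\<lbrakk>specialization_le X x y; closedin X C; y \<in> C\<rbrakk> \<Longrightarrow> x \<in> C"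
  using closure_of_minimal[of "{y}" C X] by (auto simp: specialization_le_def)

lemma specialization_le_openin:
  "\<lbrakk>specialization_le X x y; openin X U; x \<in> U\<rbrakk> \<Longrightarrow> y \<in> U"
  by (auto simp: specialization_le_def in_closure_of)

lemma specialization_le_antisym:
  assumes "t0_space X" "specialization_le X x y" "specialization_le X y x"
  shows "x = y"
  using assms unfolding t0_space_def
  by (meson specialization_le_def specialization_le_openin)

lemma continuous_map_specialization_le:
  assumes "continuous_map X Y f" "specialization_le X x y"
  shows "specialization_le Y (f x) (f y)"
  using assms continuous_map_image_closure_subset[OF assms(1), of "{y}"]
  by (auto simp: specialization_le_def continuous_map_def)

section \<open>Principal filters and closures of directed sets\<close>

text \<open>For \<open>a\<close> in the carrier this is the saturation of \<open>{a}\<close>,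
  equivalently the intersection of all open neighbourhoods of \<open>a\<close>.\<close>

definition principal_filter :: "'a topology \<Rightarrow> 'a \<Rightarrow> 'a set" where
  "principal_filter X a = {y. specialization_le X a y}"

lemma principal_filter_compact_saturated:
  assumes "a \<in> topspace X"
  shows "principal_filter X a \<in> compact_saturated X"
proof -
  have "a \<in> principal_filter X a"
    using assms by (simp add: principal_filter_def specialization_le_refl)
  moreover have "upper_in X (principal_filter X a)"
    unfolding upper_in_def
  proof (intro conjI allI impI)
    show "principal_filter X a \<subseteq> topspace X"
      by (auto simp: principal_filter_def specialization_le_def)
    show "y \<in> principal_filter X a"
      if "x \<in> principal_filter X a" "specialization_le X x y" for x y
      using that specialization_le_trans[of X a x y] by (simp add: principal_filter_def)
  qed
  moreover have "compactin X (principal_filter X a)"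
    unfolding compactin_def
  proof (intro conjI allI impI)
    show "principal_filter X a \<subseteq> topspace X"
      by (auto simp: principal_filter_def specialization_le_def)
    fix \<U> assume U: "Ball \<U> (openin X) \<and> principal_filter X a \<subseteq> \<Union>\<U>"
    with \<open>a \<in> principal_filter X a\<close> obtain V where V: "V \<in> \<U>" "a \<in> V" by blast
    \<comment> \<open>Open sets are upper sets, so the one member of the cover that contains
      \<open>a\<close> already covers everything.\<close>
    with U have "principal_filter X a \<subseteq> V"
      using specialization_le_openin[of X a _ V] by (auto simp: principal_filter_def)
    with V show "\<exists>\<F>. finite \<F> \<and> \<F> \<subseteq> \<U> \<and> principal_filter X a \<subseteq> \<Union>\<F>"
      by (intro exI[of _ "{V}"]) auto
  qed
  ultimately show ?thesis
    by (auto simp: compact_saturated_def)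
qed

text \<open>Closed sets are lower sets. This turns the condition of meeting the principal filters of
  all elements of \<open>D\<close> into inclusion of \<open>D\<close>.\<close>

lemma closedin_meets_principal_filter:
  assumes "closedin X B" "a \<in> topspace X"
  shows "B \<inter> principal_filter X a \<noteq> {} \<longleftrightarrow> a \<in> B"
  using specialization_le_refl[OF assms(2)] specialization_le_closedin[of X a _ B] assms(1)
  unfolding principal_filter_def by blast

lemma directed_in_irreducible_closure:
  assumes "directed_in X D"
  shows "irreducible_in X (X closure_of D)"
  unfolding irreducible_in_def
proof (intro conjI allI impI)
  have D: "D \<noteq> {}" "D \<subseteq> topspace X" "D \<subseteq> X closure_of D"
    using assms by (auto simp: directed_in_def closure_of_subset)
  then show "X closure_of D \<noteq> {}" by blast
  show "X closure_of D \<subseteq> topspace X" by (rule closure_of_subset_topspace)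
  fix F1 F2 assume F: "closedin X F1" "closedin X F2" "X closure_of D \<subseteq> F1 \<union> F2"
  have "D \<subseteq> F1 \<or> D \<subseteq> F2"
  proof (rule ccontr)
    assume "\<not> ?thesis"
    then obtain x y where xy: "x \<in> D" "x \<notin> F1" "y \<in> D" "y \<notin> F2" by blast
    \<comment> \<open>An upper bound \<open>z\<close> of two points that escape \<open>F1\<close>
      and \<open>F2\<close> respectively escapes both, because closed sets are lower sets.\<close>
    with assms obtain z where "z \<in> D" "specialization_le X x z" "specialization_le X y z"
      unfolding directed_in_def by blast
    with xy F D show False using specialization_le_closedin by (metis UnE subsetD)
  qed
  with F show "X closure_of D \<subseteq> F1 \<or> X closure_of D \<subseteq> F2"
    by (meson closure_of_minimal)
qed

lemma singleton_directed_in: "a \<in> topspace X \<Longrightarrow> directed_in X {a}"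
  by (auto simp: directed_in_def specialization_le_refl)

lemma sober_spaceI:
  assumes "t0_space X"
    and "\<And>A. \<lbrakk>closedin X A; irreducible_in X A\<rbrakk> \<Longrightarrow> \<exists>a\<in>topspace X. A = X closure_of {a}"
  shows "sober_space X"
  unfolding sober_space_def using assms t0_space_closure_of_sing by metis

lemma sober_space_genericE:
  assumes "sober_space X" "closedin X A" "irreducible_in X A"
  obtains a where "a \<in> topspace X" "A = X closure_of {a}"
  using assms unfolding sober_space_def by blast

section \<open>Consequences of sobriety\<close>

lemma sober_imp_DC_space: "sober_space X \<Longrightarrow> DC_space X"
  unfolding DC_space_def sober_space_def by (meson singleton_directed_in)

text \<open>The supremum is the generic point of the irreducible set \<open>X closure_of D\<close>.
  Membership in that closure is recorded because it yields Scott openness: every open set around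
  \<open>s\<close> then meets \<open>D\<close>.\<close>

lemma sober_imp_directed_sup:
  assumes "sober_space X" "directed_in X D"
  obtains s where "is_sup_in X D s" "s \<in> X closure_of D"
proof -
  obtain a where a: "a \<in> topspace X" "X closure_of D = X closure_of {a}"
    using sober_space_genericE[OF assms(1) closedin_closure_of]
      directed_in_irreducible_closure[OF assms(2)] by metis
  have D: "D \<subseteq> topspace X" using assms(2) by (simp add: directed_in_def)
  have "specialization_le X x a" if "x \<in> D" for x
    using that D a closure_of_subset[OF D] by (auto simp: specialization_le_def)
  moreover have "specialization_le X a u"
    if "u \<in> topspace X" "\<forall>x\<in>D. specialization_le X x u" for u
  proof -
    have "D \<subseteq> X closure_of {u}" using that by (auto simp: specialization_le_def)
    then have "X closure_of D \<subseteq> X closure_of {u}" by (simp add: closure_of_minimal)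
    moreover have "a \<in> X closure_of {a}" using closure_of_subset[of "{a}" X] a by auto
    ultimately show ?thesis using a that by (auto simp: specialization_le_def)
  qed
  ultimately have "is_sup_in X D a" using a by (simp add: is_sup_in_def)
  moreover have "a \<in> X closure_of D" using closure_of_subset[of "{a}" X] a by auto
  ultimately show ?thesis using that by blast
qed

lemma sober_imp_d_space:
  assumes "sober_space X"
  shows "d_space X"
proof -
  have t0: "t0_space X" using assms by (simp add: sober_space_def)
  have "scott_open X U" if U: "openin X U" for U
    unfolding scott_open_def upper_in_def
  proof (intro conjI allI impI)
    show "U \<subseteq> topspace X" using U by (rule openin_subset)
    show "y \<in> U" if "x \<in> U" "specialization_le X x y" for x y
      using that U specialization_le_openin by metis
    fix D s assume D: "directed_in X D" "is_sup_in X D s" "s \<in> U"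
    obtain t where t: "is_sup_in X D t" "t \<in> X closure_of D"
      using sober_imp_directed_sup[OF assms D(1)] .
    \<comment> \<open>Scott openness concerns an arbitrary supremum \<open>s\<close>; antisymmetry
      identifies it with the one known to lie in the closure.\<close>
    then have "t = s"
      using D(2) t0 unfolding is_sup_in_def by (meson specialization_le_antisym)
    with t D U show "D \<inter> U \<noteq> {}" by (auto simp: in_closure_of)
  qed
  then show ?thesis
    using t0 assms unfolding d_space_def specialization_dcpo_def
    by (meson sober_imp_directed_sup)
qed

section \<open>Well-filteredness of sober spaces\<close>

lemma filtered_family_maximal_open:
  assumes \<K>: "filtered_family X \<K>" and U: "openin X U" "\<And>K. K \<in> \<K> \<Longrightarrow> \<not> K \<subseteq> U"
  obtains V where "openin X V" "U \<subseteq> V" "\<And>K. K \<in> \<K> \<Longrightarrow> \<not> K \<subseteq> V"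
    "\<And>W. \<lbrakk>openin X W; V \<subset> W\<rbrakk> \<Longrightarrow> \<exists>K\<in>\<K>. K \<subseteq> W"
proof -
  define \<A> where "\<A> = {V. openin X V \<and> U \<subseteq> V \<and> (\<forall>K\<in>\<K>. \<not> K \<subseteq> V)}"
  have "\<exists>V\<in>\<A>. \<forall>W\<in>\<A>. V \<subseteq> W \<longrightarrow> W = V"
  proof (rule subset_Zorn_nonempty)
    show "\<A> \<noteq> {}" using U by (auto simp: \<A>_def)
    fix \<C> assume C: "\<C> \<noteq> {}" "subset.chain \<A> \<C>"
    then have op: "V \<in> \<C> \<Longrightarrow> openin X V \<and> U \<subseteq> V" for V
      by (auto simp: subset_chain_def \<A>_def)
    have "\<not> K \<subseteq> \<Union>\<C>" if K: "K \<in> \<K>" for K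
    proof
      assume "K \<subseteq> \<Union>\<C>"
      moreover have "compactin X K"
        using K \<K> by (auto simp: filtered_family_def compact_saturated_def)
      ultimately obtain \<F> where F: "finite \<F>" "\<F> \<subseteq> \<C>" "K \<subseteq> \<Union>\<F>"
        using op unfolding compactin_def by meson
      have "K \<noteq> {}" using K \<K> by (auto simp: filtered_family_def compact_saturated_def)
      with F have "\<F> \<noteq> {}" by auto
      \<comment> \<open>The union of a finite nonempty subset of a chain is its largest member. So
        \<open>K\<close> would lie in a single member of the chain, which \<open>\<A>\<close>
        forbids.\<close>
      then have "\<Union>\<F> \<in> \<C>"
        using F C by (meson Union_in_chain subset_chain_def subset_iff)
      with F K C show False by (auto simp: subset_chain_def \<A>_def)
    qed
    then show "\<Union>\<C> \<in> \<A>" using C op by (auto simp: \<A>_def)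
  qed
  then obtain V where V: "V \<in> \<A>" and max: "\<And>W. \<lbrakk>W \<in> \<A>; V \<subseteq> W\<rbrakk> \<Longrightarrow> W = V" by blast
  show ?thesis
  proof
    show "openin X V" "U \<subseteq> V" using V by (simp_all add: \<A>_def)
    show "\<not> K \<subseteq> V" if "K \<in> \<K>" for K using V that by (simp add: \<A>_def)
    show "\<exists>K\<in>\<K>. K \<subseteq> W" if "openin X W" "V \<subset> W" for W
    proof (rule ccontr)
      assume "\<not> ?thesis"
      then have "W \<in> \<A>" using that V by (auto simp: \<A>_def)
      with max that show False by blast
    qed
  qed
qed

lemma sober_imp_well_filtered_space:
  assumes "sober_space X"
  shows "well_filtered_space X"
  unfolding well_filtered_space_def
proof (intro conjI allI impI)
  show "t0_space X" using assms by (simp add: sober_space_def)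
  fix U \<K> assume U: "openin X U" and \<K>: "filtered_family X \<K>" and sub: "\<Inter>\<K> \<subseteq> U"
  show "\<exists>K\<in>\<K>. K \<subseteq> U"
  proof (rule ccontr)
    assume "\<not> ?thesis"
    then have "\<not> K \<subseteq> U" if "K \<in> \<K>" for K using that by blast
    then obtain V where V: "openin X V" "U \<subseteq> V" "\<And>K. K \<in> \<K> \<Longrightarrow> \<not> K \<subseteq> V"
        "\<And>W. \<lbrakk>openin X W; V \<subset> W\<rbrakk> \<Longrightarrow> \<exists>K\<in>\<K>. K \<subseteq> W"
      using filtered_family_maximal_open[OF \<K> U] by metis
    define A where "A = topspace X - V"
    have Kup: "upper_in X K" if "K \<in> \<K>" for K
      using that \<K> by (auto simp: filtered_family_def compact_saturated_def)
    then have Ksub: "K \<subseteq> topspace X" if "K \<in> \<K>" for K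
      using that by (auto simp: upper_in_def)
    obtain K0 where "K0 \<in> \<K>" using \<K> by (auto simp: filtered_family_def)
    have "irreducible_in X A"
      unfolding irreducible_in_def
    proof (intro conjI allI impI)
      show "A \<noteq> {}" using V(3)[OF \<open>K0 \<in> \<K>\<close>] Ksub[OF \<open>K0 \<in> \<K>\<close>] by (auto simp: A_def)
      show "A \<subseteq> topspace X" by (auto simp: A_def)
      fix F1 F2 assume F: "closedin X F1" "closedin X F2" "A \<subseteq> F1 \<union> F2"
      \<comment> \<open>A closed set that fails to include \<open>A\<close> leaves out a point of
        \<open>A\<close>. Adding its complement therefore enlarges \<open>V\<close> strictly, and
        maximality applies.\<close>
      have cover: "\<exists>K\<in>\<K>. K \<subseteq> V \<union> (topspace X - F)" if "closedin X F" "\<not> A \<subseteq> F" for F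
      proof (rule V(4))
        show "openin X (V \<union> (topspace X - F))" using that V(1) by blast
        show "V \<subset> V \<union> (topspace X - F)" using that by (auto simp: A_def)
      qed
      show "A \<subseteq> F1 \<or> A \<subseteq> F2"
      proof (rule ccontr)
        assume "\<not> ?thesis"
        then obtain K1 K2 where "K1 \<in> \<K>" "K1 \<subseteq> V \<union> (topspace X - F1)"
            "K2 \<in> \<K>" "K2 \<subseteq> V \<union> (topspace X - F2)"
          using cover F by meson
        moreover from this obtain K3 where K3: "K3 \<in> \<K>" and "K3 \<subseteq> K1 \<inter> K2"
          using \<K> unfolding filtered_family_def by blast
        \<comment> \<open>The two enlargements intersect in \<open>V\<close> together with the
          complement of \<open>F1\<close> union \<open>F2\<close>; the latter lies in
          \<open>V\<close> since \<open>F1\<close> and \<open>F2\<close> cover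
          \<open>A\<close>.\<close>
        ultimately have "K3 \<subseteq> V" using F(3) unfolding A_def by blast
        with V(3) K3 show False by blast
      qed
    qed
    moreover have "closedin X A" using V(1) by (auto simp: A_def)
    ultimately obtain a where a: "a \<in> topspace X" "A = X closure_of {a}"
      using sober_space_genericE[OF assms] by metis
    \<comment> \<open>Each \<open>K\<close> meets \<open>A\<close> in some \<open>x\<close>, every
      point of \<open>A\<close> is below the generic point \<open>a\<close>, and \<open>K\<close> is
      an upper set.\<close>
    have "a \<in> K" if K: "K \<in> \<K>" for K
    proof -
      obtain x where "x \<in> K" "x \<in> A" using V(3)[OF K] Ksub[OF K] by (auto simp: A_def)
      then have "specialization_le X x a" using a by (auto simp: specialization_le_def in_closure_of)
      with Kup[OF K] \<open>x \<in> K\<close> show ?thesis by (auto simp: upper_in_def)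
    qed
    then have "a \<in> V" using sub V(2) by blast
    moreover have "a \<in> A" using closure_of_subset[of "{a}" X] a by auto
    ultimately show False by (simp add: A_def)
  qed
qed

lemma continuous_map_closure_of_generic:
  assumes "continuous_map X Y f" "a \<in> topspace X"
  shows "Y closure_of (f ` (X closure_of {a})) = Y closure_of {f a}"
proof
  show "Y closure_of (f ` (X closure_of {a})) \<subseteq> Y closure_of {f a}"
    using continuous_map_image_closure_subset[OF assms(1), of "{a}"]
    by (intro closure_of_minimal) auto
  show "Y closure_of {f a} \<subseteq> Y closure_of (f ` (X closure_of {a}))"
    using closure_of_subset[of "{a}" X] assms(2) by (intro closure_of_mono) auto
qed

lemma sober_imp_WD_space:
  assumes "sober_space X"
  shows "WD_space u X"
  unfolding WD_space_def WD_set_def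
proof (intro conjI allI impI)
  show "t0_space X" using assms by (simp add: sober_space_def)
next
  fix A assume A: "closedin X A" "irreducible_in X A"
  show "A \<subseteq> topspace X" using A(1) by (rule closedin_subset)
  fix Y :: "'b topology" and f
  assume Y: "well_filtered_space Y" and f: "continuous_map X Y f"
  obtain a where a: "a \<in> topspace X" "A = X closure_of {a}"
    using sober_space_genericE[OF assms A] .
  \<comment> \<open>The image of the generic point is the required point of \<open>Y\<close>; the T0
    property of \<open>Y\<close> makes it unique.\<close>
  have "f a \<in> topspace Y" using f a by (auto simp: continuous_map_def)
  moreover have "t0_space Y" using Y by (simp add: well_filtered_space_def)
  ultimately show "\<exists>!y. y \<in> topspace Y \<and> Y closure_of (f ` A) = Y closure_of {y}"
    using continuous_map_closure_of_generic[OF f a(1)] a(2)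
    by (metis t0_space_closure_of_sing)
qed

section \<open>Sufficient conditions for sobriety\<close>

lemma DC_d_space_imp_sober:
  assumes "DC_space X" "d_space X"
  shows "sober_space X"
proof (rule sober_spaceI)
  show "t0_space X" using assms by (simp add: DC_space_def)
  fix A assume "closedin X A" "irreducible_in X A"
  then obtain D where D: "directed_in X D" "A = X closure_of D"
    using assms by (auto simp: DC_space_def)
  obtain s where s: "is_sup_in X D s"
    using assms D by (auto simp: d_space_def specialization_dcpo_def)
  then have st: "s \<in> topspace X" by (simp add: is_sup_in_def)
  \<comment> \<open>Scott openness puts the supremum into the closure of \<open>D\<close>.\<close>
  have "D \<inter> U \<noteq> {}" if "openin X U" "s \<in> U" for U
    using assms(2) that D(1) s by (auto simp: d_space_def scott_open_def)
  then have "s \<in> A" using st D(2) by (auto simp: in_closure_of)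
  then have "X closure_of {s} \<subseteq> A" using D(2) by (simp add: closure_of_minimal)
  moreover have "A \<subseteq> X closure_of {s}"
    unfolding D(2) using s
    by (intro closure_of_minimal) (auto simp: is_sup_in_def specialization_le_def)
  ultimately show "\<exists>a\<in>topspace X. A = X closure_of {a}" using st by blast
qed

text \<open>A closed set meets all principal filters of elements of \<open>D\<close> exactly when it
  includes \<open>D\<close>, so \<open>X closure_of D\<close> is the least such set. An upper bound
  of two elements has a principal filter inside both of theirs, hence the family is
  filtered.\<close>

lemma rudin_set_closure_of_directed:
  assumes D: "directed_in X D"
  shows "rudin_set X (X closure_of D)"
proof -
  have DX: "D \<subseteq> topspace X" "D \<noteq> {}" using D by (auto simp: directed_in_def)
  have "\<exists>K\<in>principal_filter X ` D. K \<subseteq> principal_filter X x \<inter> principal_filter X y"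
    if xy: "x \<in> D" "y \<in> D" for x y
  proof -
    obtain z where "z \<in> D" "specialization_le X x z" "specialization_le X y z"
      using D xy unfolding directed_in_def by blast
    moreover from this have "principal_filter X z \<subseteq> principal_filter X x \<inter> principal_filter X y"
      by (auto simp: principal_filter_def elim: specialization_le_trans)
    ultimately show ?thesis by blast
  qed
  then have "filtered_family X (principal_filter X ` D)"
    using DX by (auto simp: filtered_family_def intro: principal_filter_compact_saturated)
  moreover have meets: "meets_all B (principal_filter X ` D) \<longleftrightarrow> D \<subseteq> B" if "closedin X B" for B
    using closedin_meets_principal_filter[OF that] DX unfolding meets_all_def by blast
  moreover have "X closure_of D \<noteq> {}" using DX closure_of_subset[OF DX(1)] by auto
  ultimately show ?thesis
    unfolding rudin_set_def using closure_of_subset[OF DX(1)] closure_of_minimal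
    by (metis closedin_closure_of subset_antisym)
qed

lemma DC_imp_rudin_space: "DC_space X \<Longrightarrow> rudin_space X"
  unfolding DC_space_def rudin_space_def using rudin_set_closure_of_directed by blast

lemma well_filtered_rudin_set_generic:
  assumes "well_filtered_space X" "rudin_set X A"
  shows "\<exists>a\<in>topspace X. A = X closure_of {a}"
proof -
  obtain \<K> where A: "closedin X A" and \<K>: "filtered_family X \<K>" "meets_all A \<K>"
    and min: "\<And>B. \<lbrakk>closedin X B; meets_all B \<K>; B \<subseteq> A\<rbrakk> \<Longrightarrow> B = A"
    using assms(2) unfolding rudin_set_def by blast
  have "openin X (topspace X - A)" using A by blast
  moreover have "\<not> K \<subseteq> topspace X - A" if "K \<in> \<K>" for K
    using that \<K>(2) by (auto simp: meets_all_def)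
  ultimately have "\<not> \<Inter>\<K> \<subseteq> topspace X - A"
    using assms(1) \<K>(1) unfolding well_filtered_space_def by blast
  moreover have "\<Inter>\<K> \<subseteq> topspace X"
    using \<K>(1) by (auto simp: filtered_family_def compact_saturated_def upper_in_def)
  ultimately obtain a where a: "a \<in> \<Inter>\<K>" "a \<in> A" "a \<in> topspace X" by blast
  have "a \<in> X closure_of {a}" using closure_of_subset[of "{a}" X] a by auto
  then have "meets_all (X closure_of {a}) \<K>" using a by (auto simp: meets_all_def)
  moreover have "X closure_of {a} \<subseteq> A" using a A by (simp add: closure_of_minimal)
  ultimately have "X closure_of {a} = A" by (intro min) simp_all
  with a show ?thesis by blast
qed

lemma well_filtered_rudin_space_imp_sober:
  "\<lbrakk>well_filtered_space X; rudin_space X\<rbrakk> \<Longrightarrow> sober_space X"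
  by (simp add: rudin_space_def sober_spaceI well_filtered_rudin_set_generic)

section \<open>Transport of well-filteredness and of generic points along homeomorphisms\<close>

lemma homeomorphic_maps_compact_saturated:
  assumes hom: "homeomorphic_maps X Y f g" and K: "K \<in> compact_saturated X"
  shows "f ` K \<in> compact_saturated Y"
proof -
  have f: "continuous_map X Y f" and g: "continuous_map Y X g"
    and gf: "\<And>x. x \<in> topspace X \<Longrightarrow> g (f x) = x" and fg: "\<And>y. y \<in> topspace Y \<Longrightarrow> f (g y) = y"
    using hom by (auto simp: homeomorphic_maps_def)
  have Ks: "K \<noteq> {}" "compactin X K" "upper_in X K" "K \<subseteq> topspace X"
    using K by (auto simp: compact_saturated_def upper_in_def)
  have "y \<in> f ` K" if "x \<in> K" "specialization_le Y (f x) y" for x y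
  proof -
    \<comment> \<open>Continuous maps are monotone, so a point above \<open>f x\<close> is pulled
      back by \<open>g\<close> to a point above \<open>x\<close>, where saturation of
      \<open>K\<close> applies.\<close>
    have "specialization_le X x (g y)"
      using continuous_map_specialization_le[OF g that(2)] gf that(1) Ks(4) by auto
    then have "g y \<in> K" using Ks(3) that(1) by (auto simp: upper_in_def)
    moreover have "y = f (g y)" using fg that(2) by (simp add: specialization_le_def)
    ultimately show ?thesis by blast
  qed
  moreover have "f ` K \<subseteq> topspace Y"
    using Ks(4) f by (auto simp: continuous_map_def)
  ultimately show ?thesis
    using Ks image_compactin[OF Ks(2) f] by (auto simp: compact_saturated_def upper_in_def)
qed

lemma homeomorphic_well_filtered_space:
  assumes "X homeomorphic_space Y" and X: "well_filtered_space X"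
  shows "well_filtered_space Y"
proof -
  obtain f g where hom: "homeomorphic_maps X Y f g"
    using assms(1) by (auto simp: homeomorphic_space_def)
  then have gf: "homeomorphic_maps Y X g f" by (rule homeomorphic_maps_sym[THEN iffD1])
  from hom have f: "continuous_map X Y f" and fg: "\<And>y. y \<in> topspace Y \<Longrightarrow> f (g y) = y"
    and g: "\<And>y. y \<in> topspace Y \<Longrightarrow> g y \<in> topspace X"
    unfolding homeomorphic_maps_def continuous_map_def by blast+
  have "\<exists>K\<in>\<K>. K \<subseteq> U"
    if U: "openin Y U" and \<K>: "filtered_family Y \<K>" and sub: "\<Inter>\<K> \<subseteq> U" for U \<K>
  proof -
    have KY: "K \<subseteq> topspace Y" if "K \<in> \<K>" for K
      using that \<K> by (auto simp: filtered_family_def compact_saturated_def upper_in_def)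
    \<comment> \<open>The family is moved to \<open>X\<close> along \<open>g\<close> and the open
      set along the preimage of \<open>f\<close>, so that well-filteredness of \<open>X\<close> can
      be applied there.\<close>
    have "filtered_family X ((`) g ` \<K>)"
      unfolding filtered_family_def
    proof (intro conjI ballI)
      show "(`) g ` \<K> \<noteq> {}" "(`) g ` \<K> \<subseteq> compact_saturated X"
        using \<K> homeomorphic_maps_compact_saturated[OF gf] unfolding filtered_family_def by blast+
      fix L1 L2 assume "L1 \<in> (`) g ` \<K>" "L2 \<in> (`) g ` \<K>"
      then obtain K1 K2 where K: "K1 \<in> \<K>" "K2 \<in> \<K>" "L1 = g ` K1" "L2 = g ` K2" by blast
      with \<K> obtain K3 where "K3 \<in> \<K>" "K3 \<subseteq> K1 \<inter> K2"
        unfolding filtered_family_def by blast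
      with K show "\<exists>L3\<in>(`) g ` \<K>. L3 \<subseteq> L1 \<inter> L2" by blast
    qed
    moreover have "openin X {x \<in> topspace X. f x \<in> U}"
      using f U by (rule openin_continuous_map_preimage)
    moreover have "\<Inter>((`) g ` \<K>) \<subseteq> {x \<in> topspace X. f x \<in> U}"
    proof
      fix x assume x: "x \<in> \<Inter>((`) g ` \<K>)"
      have "f x \<in> K" if "K \<in> \<K>" for K
      proof -
        have "x \<in> g ` K" using x that by simp
        then obtain y where y: "y \<in> K" "x = g y" by blast
        then have "f x = y" using KY[OF that] by (simp add: fg subset_iff)
        with y show ?thesis by simp
      qed
      \<comment> \<open>A member of the family is needed to place \<open>x\<close> in the carrier,
        as an intersection over the empty family would be the whole type.\<close>
      moreover obtain K where "K \<in> \<K>" using \<K> by (auto simp: filtered_family_def)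
      then have "x \<in> topspace X"
        using x KY g by (metis INT_E imageE subsetD)
      ultimately show "x \<in> {x \<in> topspace X. f x \<in> U}" using sub by blast
    qed
    ultimately have "\<exists>L\<in>(`) g ` \<K>. L \<subseteq> {x \<in> topspace X. f x \<in> U}"
      using X unfolding well_filtered_space_def by blast
    then obtain K where K: "K \<in> \<K>" "g ` K \<subseteq> {x \<in> topspace X. f x \<in> U}" by blast
    have "y \<in> U" if "y \<in> K" for y
    proof -
      have "f (g y) \<in> U" using K that by blast
      moreover have "y \<in> topspace Y" using KY K(1) that by blast
      ultimately show ?thesis by (simp add: fg)
    qed
    with K show ?thesis by blast
  qed
  moreover have "t0_space Y"
    using assms homeomorphic_t0_space by (auto simp: well_filtered_space_def)
  ultimately show ?thesis by (auto simp: well_filtered_space_def)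
qed

text \<open>The WD property is tested on \<open>h\<close> itself. Since \<open>h\<close> commutes
  with closures and is injective on the carrier, the point obtained in \<open>Y\<close> comes from a
  generic point of \<open>A\<close>.\<close>

lemma homeomorphic_map_WD_set_generic:
  fixes Y :: "'u topology"
  assumes hom: "homeomorphic_map X Y h" and X: "well_filtered_space X"
    and WD: "WD_set TYPE('u) X A" and A: "closedin X A"
  shows "\<exists>a\<in>topspace X. A = X closure_of {a}"
proof -
  have "well_filtered_space Y"
    using hom X homeomorphic_map_imp_homeomorphic_space homeomorphic_well_filtered_space by blast
  then obtain y where y: "y \<in> topspace Y" "Y closure_of (h ` A) = Y closure_of {y}"
    using WD hom homeomorphic_imp_continuous_map unfolding WD_set_def by blast
  then obtain a where a: "a \<in> topspace X" "y = h a"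
    using homeomorphic_imp_surjective_map[OF hom] by blast
  have AX: "A \<subseteq> topspace X" using A by (rule closedin_subset)
  have "h ` A = h ` (X closure_of {a})"
    using homeomorphic_map_closure_of[OF hom, of A] homeomorphic_map_closure_of[OF hom, of "{a}"]
      y(2) a AX closure_of_closedin[OF A] by simp
  then have "A = X closure_of {a}"
    using homeomorphic_imp_injective_map[OF hom] AX closure_of_subset_topspace
    by (metis inj_on_image_eq_iff)
  with a show ?thesis by blast
qed

text \<open>This builds a copy of \<open>X\<close> in another type. Restricting the carrier to
  \<open>range h\<close> makes \<open>g\<close> injective on it, so \<open>g\<close> is a two-sided
  inverse there.\<close>

lemma homeomorphic_map_pullback_inv:
  assumes "\<And>x. g (h x) = x"
  shows "homeomorphic_map X (pullback_topology (range h) g X) h"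
proof -
  have "homeomorphic_maps X (pullback_topology (range h) g X) h g"
    unfolding homeomorphic_maps_def
  proof (intro conjI ballI)
    show "continuous_map X (pullback_topology (range h) g X) h"
      using assms by (intro continuous_map_pullback') (auto simp: o_def)
    show "continuous_map (pullback_topology (range h) g X) X g"
      using continuous_map_pullback[of X X id "range h" g] by (simp add: o_def id_def)
  qed (use assms in \<open>auto simp: topspace_pullback_topology\<close>)
  then show ?thesis by (auto simp: homeomorphic_map_maps)
qed

lemma well_filtered_WD_space_imp_sober:
  fixes X :: "'a topology"
  assumes X: "well_filtered_space X" and WD: "WD_space TYPE('a + 'b) X"
  shows "sober_space X"
proof (rule sober_spaceI)
  show "t0_space X" using X by (simp add: well_filtered_space_def)
  \<comment> \<open>The left summand of \<open>'a + 'b\<close> holds a copy of \<open>X\<close>,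
    which serves as the well-filtered target space in the WD condition.\<close>
  have hom: "homeomorphic_map X (pullback_topology (range Inl) projl X) (Inl :: 'a \<Rightarrow> 'a + 'b)"
    by (rule homeomorphic_map_pullback_inv) simp
  fix A assume "closedin X A" "irreducible_in X A"
  then show "\<exists>a\<in>topspace X. A = X closure_of {a}"
    using homeomorphic_map_WD_set_generic[OF hom X] WD by (auto simp: WD_space_def)
qed

theorem theorem6p6:
  fixes X :: "'a topology"
  assumes "t0_space X"
  shows "(sober_space X \<longleftrightarrow> DC_space X \<and> d_space X) \<and>
         (sober_space X \<longleftrightarrow> well_filtered_space X \<and> DC_space X) \<and>
         (sober_space X \<longleftrightarrow> well_filtered_space X \<and> rudin_space X) \<and>
         (sober_space X \<longleftrightarrow> well_filtered_space X \<and> WD_space TYPE('a + 'b) X)"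
proof (intro conjI iffI)
  assume S: "sober_space X"
  show "DC_space X" "DC_space X" using S by (fact sober_imp_DC_space)+
  show "d_space X" using S by (fact sober_imp_d_space)
  show "well_filtered_space X" "well_filtered_space X" "well_filtered_space X"
    using S by (fact sober_imp_well_filtered_space)+
  show "rudin_space X" using S by (intro DC_imp_rudin_space sober_imp_DC_space)
  show "WD_space TYPE('a + 'b) X" using S by (rule sober_imp_WD_space)
next
  assume "DC_space X \<and> d_space X"
  then show "sober_space X" using DC_d_space_imp_sober by blast
next
  assume "well_filtered_space X \<and> DC_space X"
  then show "sober_space X" using DC_imp_rudin_space well_filtered_rudin_space_imp_sober by blast
next
  assume "well_filtered_space X \<and> rudin_space X"
  then show "sober_space X" using well_filtered_rudin_space_imp_sober by blast
next
  assume "well_filtered_space X \<and> WD_space TYPE('a + 'b) X"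
  then show "sober_space X" using well_filtered_WD_space_imp_sober by blast
qed

end
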